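(* Suppose assumptions (A1) and (A2) of the context hold. Let $\epsilon\in(0,1)$ and consider a set $\mathcal R^\epsilon\subseteq\mathbb R^n$ satisfying, for any $s_0\in\mathcal R^\epsilon$, $$A_K\mathcal R^\epsilon\oplus\mathcal E(\Sigma_\omega,\mu_\omega,n/\epsilon)\subseteq\mathcal R^\epsilon .$$ Then $\mathcal R^\epsilon$ is a probabilistic positively invariant set, with probability $1-\epsilon$, for the system $s_{k+1}=A_Ks_k+w_k$, $w_k\sim\omega$, $k\in\mathbb N$.
   Context: Notation: $\mathbb N$ is the set of non-negative integers, $\mathbb N_+$ the positive integers; $\mathbb S^n_{++}$ is the set of symmetric positive definite $n\times n$ matrices; $\mathcal X\oplus\mathcal Y=\{x+y:x\in\mathcal X,y\in\mathcal Y\}$; $M\mathcal X=\{Mx:x\in\mathcal X\}$. For $M\in\mathbb S^n_{++}$, $c\in\mathbb R^n$, $r>0$: $\mathcal E(M,c,r)=\{x:(x-c)^\intercal M^{-1}(x-c)\le r\}$. (A1) The pair $(A,B)\in\mathbb R^{n\times n}\times\mathbb R^{n\times m}$ is known and strictly stabilizable; $\mathcal X\subseteq\mathbb R^n$ is a convex polyhedron and $\mathcal U\subseteq\mathbb R^m$ is a convex polytope, both containing the origin in their interior and given by finite irredundant inequality representations (state and input constraint sets); the probability distribution $\omega$ on $\mathbb R^n$ has known mean $\mu_\omega\in\mathbb R^n$ and covariance $\Sigma_\omega\in\mathbb S^n_{++}$. (A2) $K\in\mathbb R^{m\times n}$ is given and $A_K:=A+BK$ is strictly stable (all eigenvalues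 in the open unit disc). The disturbances $w_0,w_1,\dots$ are independent, identically distributed with law $\omega$, and $w_k$ is independent of $s_0,\dots,s_k$. Definition: a set $\mathcal S\subseteq\mathbb R^n$ is probabilistic positively invariant for the system $s_{k+1}=A_Ks_k+w_k$ with probability $1-\epsilon$ if and only if, for any $s_0\in\mathcal S$, $\Pr(s_k\in\mathcal S\mid s_0)\ge1-\epsilon$ for all $k\in\mathbb N_+$. *)

theory Defs
  imports "HOL-Probability.Probability"
begin

definition strictly_stable :: "real^'n^'n \<Rightarrow> bool" where
  "strictly_stable F \<longleftrightarrow>
     (\<forall>(z::complex) v. v \<noteq> 0 \<longrightarrow> (\<chi> i j. complex_of_real (F $ i $ j)) *v v = z *s v \<longrightarrow> cmod z < 1)"

definition strictly_stabilizable :: "real^'n^'n \<Rightarrow> real^'m^'n \<Rightarrow> bool" where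
  "strictly_stabilizable A B \<longleftrightarrow> (\<exists>K. strictly_stable (A + B ** K))"

definition sym_pos_def :: "real^'n^'n \<Rightarrow> bool" where
  "sym_pos_def P \<longleftrightarrow> transpose P = P \<and> (\<forall>x. x \<noteq> 0 \<longrightarrow> x \<bullet> (P *v x) > 0)"

definition ellipsoid :: "real^'n^'n \<Rightarrow> real^'n \<Rightarrow> real \<Rightarrow> (real^'n) set" where
  "ellipsoid P c r = {x. (x - c) \<bullet> (matrix_inv P *v (x - c)) \<le> r}"

text \<open>A pair \<open>(a, b)\<close> in \<open>H\<close> stands for the inequality \<open>a \<bullet> x \<le> b\<close>.\<close>

definition solution_set :: "('v::real_inner \<times> real) set \<Rightarrow> 'v set" where
  "solution_set H = {x. \<forall>(a, b)\<in>H. a \<bullet> x \<le> b}"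

definition irredundant_rep :: "('v::real_inner \<times> real) set \<Rightarrow> 'v set \<Rightarrow> bool" where
  "irredundant_rep H X \<longleftrightarrow>
     finite H \<and> solution_set H = X \<and> (\<forall>h\<in>H. solution_set (H - {h}) \<noteq> X)"

text \<open>Integrability is part of the next two definitions, because the Bochner integral of a
  non-integrable function is 0.\<close>

definition has_mean :: "(real^'n) measure \<Rightarrow> real^'n \<Rightarrow> bool" where
  "has_mean D \<mu> \<longleftrightarrow> integrable D (\<lambda>x. x) \<and> (\<integral>x. x \<partial>D) = \<mu>"

definition has_covariance :: "(real^'n) measure \<Rightarrow> real^'n^'n \<Rightarrow> bool" where
  "has_covariance D C \<longleftrightarrow> (let \<mu> = (\<integral>x. x \<partial>D) in
     \<forall>i j. integrable D (\<lambda>x. (x $ i - \<mu> $ i) * (x $ j - \<mu> $ j)) \<and>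
           (\<integral>x. (x $ i - \<mu> $ i) * (x $ j - \<mu> $ j) \<partial>D) = C $ i $ j)"

definition iid_disturbance ::
    "'a measure \<Rightarrow> (real^'n) measure \<Rightarrow> (nat \<Rightarrow> 'a \<Rightarrow> real^'n) \<Rightarrow> bool" where
  "iid_disturbance M D w \<longleftrightarrow>
     prob_space.indep_vars M (\<lambda>_. borel) w UNIV \<and> (\<forall>k. distr M borel (w k) = D)"

text \<open>The initial state \<open>s 0\<close> may be deterministic or random. The last conjunct says that \<open>w k\<close> is
  independent of the tuple \<open>(s 0, \<dots>, s k)\<close>; it is phrased with \<open>\<sigma>\<close>-algebras because \<open>indep_var\<close>
  requires both variables to have the same type.\<close>

definition trajectory ::
    "'a measure \<Rightarrow> real^'n^'n \<Rightarrow> (nat \<Rightarrow> 'a \<Rightarrow> real^'n) \<Rightarrow> (nat \<Rightarrow> 'a \<Rightarrow> real^'n) \<Rightarrow> bool" where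
  "trajectory M F w s \<longleftrightarrow>
     (\<forall>k. s k \<in> borel_measurable M) \<and>
     (\<forall>k. \<forall>\<xi>\<in>space M. s (Suc k) \<xi> = F *v s k \<xi> + w k \<xi>) \<and>
     (\<forall>k. prob_space.indep_set M
        (sets (vimage_algebra (space M) (w k) borel))
        (sets (vimage_algebra (space M) (\<lambda>\<xi>. \<lambda>i\<in>{..k}. s i \<xi>) (PiM {..k} (\<lambda>_. borel)))))"

text \<open>The condition is \<open>Pr(s k \<in> S | s 0 = x) \<ge> 1 - \<epsilon>\<close> for every \<open>x \<in> S\<close> and every trajectory for which
  conditioning on \<open>s 0 = x\<close> makes sense; this includes the trajectory started at the fixed state \<open>x\<close>.
  As \<open>S\<close> is an arbitrary set, \<open>{s k \<in> S}\<close> need not be an event, and the probability is then read as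
  an inner probability, witnessed by the event \<open>E\<close>. For Borel sets \<open>S\<close> this is the usual
  conditional probability, as the lemma below shows.\<close>

definition prob_pos_invariant ::
    "'a measure \<Rightarrow> real^'n^'n \<Rightarrow> (nat \<Rightarrow> 'a \<Rightarrow> real^'n) \<Rightarrow> real \<Rightarrow> (real^'n) set \<Rightarrow> bool" where
  "prob_pos_invariant M F w p S \<longleftrightarrow>
     (\<forall>x\<in>S. \<forall>s. trajectory M F w s \<longrightarrow> \<P>(\<xi> in M. s 0 \<xi> = x) > 0 \<longrightarrow>
        (\<forall>k\<ge>1. \<exists>E\<in>sets M. E \<subseteq> {\<xi>\<in>space M. s k \<xi> \<in> S} \<and>
                  \<P>(\<xi> in M. \<xi> \<in> E \<bar> s 0 \<xi> = x) \<ge> p))"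

lemma prob_pos_invariant_borel:
  assumes "prob_space M" and S: "S \<in> sets borel"
  shows "prob_pos_invariant M F w p S \<longleftrightarrow>
     (\<forall>x\<in>S. \<forall>s. trajectory M F w s \<longrightarrow> \<P>(\<xi> in M. s 0 \<xi> = x) > 0 \<longrightarrow>
        (\<forall>k\<ge>1. \<P>(\<xi> in M. s k \<xi> \<in> S \<bar> s 0 \<xi> = x) \<ge> p))"
proof -
  interpret prob_space M by fact
  have "(\<exists>E\<in>sets M. E \<subseteq> {\<xi>\<in>space M. s k \<xi> \<in> S} \<and> \<P>(\<xi> in M. \<xi> \<in> E \<bar> s 0 \<xi> = x) \<ge> p)
          \<longleftrightarrow> \<P>(\<xi> in M. s k \<xi> \<in> S \<bar> s 0 \<xi> = x) \<ge> p" (is "?L \<longleftrightarrow> ?R")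
    if s: "trajectory M F w s" for s k x
  proof
    have [measurable]: "s i \<in> borel_measurable M" for i
      using s by (simp add: trajectory_def)
    note S[measurable]
    show ?R if ?L
    proof -
      from that obtain E where E: "E \<in> sets M" "E \<subseteq> {\<xi>\<in>space M. s k \<xi> \<in> S}"
        and p: "\<P>(\<xi> in M. \<xi> \<in> E \<bar> s 0 \<xi> = x) \<ge> p" by blast
      have "\<P>(\<xi> in M. \<xi> \<in> E \<and> s 0 \<xi> = x) \<le> \<P>(\<xi> in M. s k \<xi> \<in> S \<and> s 0 \<xi> = x)"
        using E by (intro finite_measure_mono) auto
      then have "\<P>(\<xi> in M. \<xi> \<in> E \<bar> s 0 \<xi> = x) \<le> \<P>(\<xi> in M. s k \<xi> \<in> S \<bar> s 0 \<xi> = x)"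
        unfolding cond_prob_def by (intro divide_right_mono) auto
      with p show ?thesis by simp
    qed
    show ?L if ?R
    proof (intro bexI conjI)
      show "{\<xi>\<in>space M. s k \<xi> \<in> S} \<in> sets M" by measurable
      have "{\<xi>\<in>space M. \<xi> \<in> {\<xi>\<in>space M. s k \<xi> \<in> S} \<and> s 0 \<xi> = x} = {\<xi>\<in>space M. s k \<xi> \<in> S \<and> s 0 \<xi> = x}"
        by auto
      then show "\<P>(\<xi> in M. \<xi> \<in> {\<xi>\<in>space M. s k \<xi> \<in> S} \<bar> s 0 \<xi> = x) \<ge> p"
        using that by (simp add: cond_prob_def)
    qed auto
  qed
  then show ?thesis
    unfolding prob_pos_invariant_def by blast
qed

end

theory Submission
  imports Defs
begin

text \<open>
  Fix a start \<open>x \<in> R\<close> and let \<open>F = A + B K\<close>. Given \<open>s 0 = x\<close>, the state \<open>s k\<close> has a mean \<open>m\<close>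
  and a covariance \<open>V\<close> that follow the recursions \<open>m \<mapsto> F m + \<mu>\<close> and \<open>V \<mapsto> F V F\<^sup>T + C\<close>, started at
  \<open>x\<close> and \<open>0\<close>, because \<open>w k\<close> has mean \<open>\<mu>\<close> and is independent of \<open>(s 0, s k)\<close>
  (\<open>state_second_moment\<close>). For \<open>k \<ge> 1\<close> the matrix \<open>V\<close> is positive definite, and Chebyshev's
  inequality in the Mahalanobis form puts \<open>s k\<close> in the ellipsoid of \<open>V\<close> about \<open>m\<close> of squared radius
  \<open>n / \<epsilon>\<close> with conditional probability at least \<open>1 - \<epsilon>\<close> (\<open>mahalanobis_chebyshev\<close>).

  It remains to see that \<open>R\<close> contains this whole ellipsoid (\<open>state_ellipsoid_subset\<close>). The
  hypothesis on \<open>R\<close> lets one add an arbitrary point of the disturbance ellipsoid at each step, and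
  the ellipsoid of \<open>F V F\<^sup>T + C\<close> lies in the sum of \<open>F\<close> applied to the ellipsoid of \<open>V\<close> and the
  ellipsoid of \<open>C\<close>. The splitting is explicit when an ellipsoid is parametrised as the set of
  points \<open>m + V u\<close> with \<open>u \<bullet> V u \<le> r\<close>: one has \<open>(F V F\<^sup>T + C) u = F (V (F\<^sup>T u)) + C u\<close>, and the
  quadratic form of the left side at \<open>u\<close> is the sum of the nonnegative quadratic forms of \<open>V\<close> at
  \<open>F\<^sup>T u\<close> and of \<open>C\<close> at \<open>u\<close>, so that each of the two is at most \<open>r\<close>. This parametrisation also
  makes sense for singular \<open>V\<close>, so the induction can begin at \<open>V = 0\<close>.
\<close>

section \<open>Mean and covariance of the state\<close>

primrec state_mean :: "real^'n^'n \<Rightarrow> real^'n \<Rightarrow> real^'n \<Rightarrow> nat \<Rightarrow> real^'n" where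
  "state_mean F \<mu> x 0 = x"
| "state_mean F \<mu> x (Suc k) = F *v state_mean F \<mu> x k + \<mu>"

primrec state_cov :: "real^'n^'n \<Rightarrow> real^'n^'n \<Rightarrow> nat \<Rightarrow> real^'n^'n" where
  "state_cov F C 0 = 0"
| "state_cov F C (Suc k) = F ** state_cov F C k ** transpose F + C"

lemma state_cov_Suc_mult:
  "state_cov F C (Suc k) *v u = F *v (state_cov F C k *v (u v* F)) + C *v u"
  by (simp add: matrix_vector_mult_add_rdistrib flip: matrix_vector_mul_assoc)

lemma state_cov_Suc_form:
  "u \<bullet> (state_cov F C (Suc k) *v v) =
     (u v* F) \<bullet> (state_cov F C k *v (v v* F)) + u \<bullet> (C *v v)"
  unfolding state_cov_Suc_mult by (simp add: inner_add_right dot_lmul_matrix)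

lemma state_cov_nonneg:
  assumes "\<And>u. u \<bullet> (C *v u) \<ge> 0"
  shows "u \<bullet> (state_cov F C k *v u) \<ge> 0"
proof (induction k arbitrary: u)
  case (Suc k)
  then show ?case
    unfolding state_cov_Suc_form using assms by (intro add_nonneg_nonneg) auto
qed simp

lemma state_cov_Suc_pos:
  assumes "\<And>u. u \<noteq> 0 \<Longrightarrow> u \<bullet> (C *v u) > 0" and "u \<noteq> 0"
  shows "u \<bullet> (state_cov F C (Suc k) *v u) > 0"
proof -
  have "v \<bullet> (C *v v) \<ge> 0" for v
    using assms(1)[of v] by (cases "v = 0") auto
  then show ?thesis
    unfolding state_cov_Suc_form
    using assms by (intro add_nonneg_pos state_cov_nonneg) auto
qed

lemma pos_form_invertible:
  fixes V :: "real^'n^'n"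
  assumes "\<And>u. u \<noteq> 0 \<Longrightarrow> u \<bullet> (V *v u) > 0"
  shows "invertible V"
proof -
  have "V *v u = 0 \<Longrightarrow> u = 0" for u
    using assms[of u] by (cases "u = 0") auto
  then show ?thesis
    by (simp add: invertible_left_inverse matrix_left_invertible_ker)
qed

section \<open>The ellipsoid of the state covariance\<close>

lemma invertible_matrix_inv_mult:
  fixes V :: "real^'n^'n"
  assumes "invertible V"
  shows "matrix_inv V *v (V *v y) = y" and "V *v (matrix_inv V *v y) = y"
proof -
  have "V ** matrix_inv V = mat 1 \<and> matrix_inv V ** V = mat 1"
    using assms unfolding invertible_def matrix_inv_def by (rule someI_ex)
  then show "matrix_inv V *v (V *v y) = y" "V *v (matrix_inv V *v y) = y"
    by (simp_all add: matrix_vector_mul_assoc)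
qed

lemma mult_in_ellipsoid:
  fixes C :: "real^'n^'n"
  assumes "invertible C" and "u \<bullet> (C *v u) \<le> r"
  shows "\<mu> + C *v u \<in> ellipsoid C \<mu> r"
proof -
  show ?thesis
    using assms by (simp add: ellipsoid_def inner_commute invertible_matrix_inv_mult)
qed

text \<open>Points of the ellipsoid are written as \<open>m + V u\<close>, which avoids the inverse of the covariance:
  the direction \<open>u\<close> for \<open>k + 1\<close> steps gives the direction \<open>F\<^sup>T u\<close> for \<open>k\<close> steps and the disturbance
  \<open>\<mu> + C u\<close> for the last step.\<close>

lemma state_ellipsoid_subset:
  fixes C F :: "real^'n^'n"
  assumes pos: "\<And>u. u \<noteq> 0 \<Longrightarrow> u \<bullet> (C *v u) > 0"
    and step: "(*v) F ` R + ellipsoid C \<mu> r \<subseteq> R"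
    and "x \<in> R"
    and "u \<bullet> (state_cov F C k *v u) \<le> r"
  shows "state_mean F \<mu> x k + state_cov F C k *v u \<in> R"
  using assms(4)
proof (induction k arbitrary: u)
  case 0
  then show ?case using \<open>x \<in> R\<close> by simp
next
  case (Suc k)
  let ?V = "state_cov F C k" and ?u = "u v* F"
  have C: "v \<bullet> (C *v v) \<ge> 0" for v
    using pos[of v] by (cases "v = 0") auto
  have "?u \<bullet> (?V *v ?u) \<ge> 0"
    using C by (rule state_cov_nonneg)
  with C[of u] Suc.prems have le: "?u \<bullet> (?V *v ?u) \<le> r" "u \<bullet> (C *v u) \<le> r"
    unfolding state_cov_Suc_form by auto
  have "F *v (state_mean F \<mu> x k + ?V *v ?u) + (\<mu> + C *v u)
          \<in> (*v) F ` R + ellipsoid C \<mu> r"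
    using le pos by (intro set_plus_intro imageI Suc.IH mult_in_ellipsoid pos_form_invertible)
  with step have "F *v (state_mean F \<mu> x k + ?V *v ?u) + (\<mu> + C *v u) \<in> R"
    by blast
  then show ?case
    unfolding state_cov_Suc_mult by (simp add: matrix_vector_right_distrib add_ac)
qed

section \<open>Second moments\<close>

lemma has_mean_centred:
  assumes "prob_space D" and "has_mean D \<mu>"
  shows "has_bochner_integral D (\<lambda>x. u \<bullet> (x - \<mu>)) 0"
proof -
  interpret prob_space D by fact
  have "has_bochner_integral D (\<lambda>x. x) \<mu>"
    using assms(2) by (simp add: has_mean_def has_bochner_integral_iff)
  then have "has_bochner_integral D (\<lambda>x. x - \<mu>) (\<mu> - \<mu>)"
    by (intro has_bochner_integral_diff) (simp_all add: has_bochner_integral_iff prob_space)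
  then have "has_bochner_integral D (\<lambda>x. u \<bullet> (x - \<mu>)) (u \<bullet> (\<mu> - \<mu>))"
    by (intro has_bochner_integral_inner_right)
  then show ?thesis by simp
qed

lemma has_covariance_form:
  assumes "has_mean D \<mu>" and "has_covariance D C"
  shows "has_bochner_integral D (\<lambda>x. (u \<bullet> (x - \<mu>)) * (v \<bullet> (x - \<mu>))) (u \<bullet> (C *v v))"
proof -
  have ij: "has_bochner_integral D (\<lambda>x. (x $ i - \<mu> $ i) * (x $ j - \<mu> $ j)) (C $ i $ j)" for i j
    using assms by (simp add: has_mean_def has_covariance_def Let_def has_bochner_integral_iff)
  have "has_bochner_integral D
      (\<lambda>x. \<Sum>i\<in>UNIV. \<Sum>j\<in>UNIV. (u $ i * v $ j) * ((x $ i - \<mu> $ i) * (x $ j - \<mu> $ j)))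
      (\<Sum>i\<in>UNIV. \<Sum>j\<in>UNIV. (u $ i * v $ j) * C $ i $ j)"
    by (intro has_bochner_integral_sum has_bochner_integral_mult_right ij)
  moreover have "(\<Sum>i\<in>UNIV. \<Sum>j\<in>UNIV. (u $ i * v $ j) * C $ i $ j) = u \<bullet> (C *v v)"
    by (simp add: inner_vec_def matrix_vector_mult_def sum_distrib_left mult_ac)
  moreover have "(\<Sum>i\<in>UNIV. \<Sum>j\<in>UNIV. (u $ i * v $ j) * ((x $ i - \<mu> $ i) * (x $ j - \<mu> $ j)))
      = (u \<bullet> (x - \<mu>)) * (v \<bullet> (x - \<mu>))" for x
    by (simp add: inner_vec_def sum_product mult_ac)
  ultimately show ?thesis by simp
qed

text \<open>Trajectories state independence for generated \<open>\<sigma>\<close>-algebras; the product formula for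
  expectations needs it for real random variables.\<close>

lemma (in prob_space) indep_set_imp_indep_var:
  assumes "indep_set (sets G) (sets H)" and "space G = space M" "space H = space M"
    and f: "f \<in> measurable G S" and g: "g \<in> measurable H T"
  shows "indep_var S f T g"
proof -
  have ev: "sets G \<subseteq> events" "sets H \<subseteq> events"
    using assms(1) by (auto dest: indep_setD_ev1 indep_setD_ev2)
  have M: "f \<in> measurable M S" "g \<in> measurable M T"
    using f g ev assms(2,3) unfolding measurable_def by auto
  have "sigma_sets (space M) {f -` A \<inter> space M |A. A \<in> sets S} \<subseteq> sets G"
    using measurable_sets[OF f] assms(2) by (subst assms(2)[symmetric]) (intro sets.sigma_sets_subset, auto)
  moreover have "sigma_sets (space M) {g -` A \<inter> space M |A. A \<in> sets T} \<subseteq> sets H"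
    using measurable_sets[OF g] assms(3) by (subst assms(3)[symmetric]) (intro sets.sigma_sets_subset, auto)
  ultimately show ?thesis
    using assms(1) M ev unfolding indep_var_eq indep_sets2_eq by blast
qed

text \<open>Of the whole past of \<open>w k\<close>, only the initial state, on which one conditions, and the current
  state enter the recursion for the moments.\<close>

lemma trajectory_indep_var:
  assumes "prob_space M" and tr: "trajectory M F w s"
    and f: "f \<in> borel_measurable borel"
    and g: "g \<in> borel_measurable (borel \<Otimes>\<^sub>M borel)"
  shows "prob_space.indep_var M borel (\<lambda>\<xi>. f (w k \<xi>)) borel (\<lambda>\<xi>. g (s 0 \<xi>, s k \<xi>))"
proof -
  interpret prob_space M by fact
  let ?G = "vimage_algebra (space M) (w k) borel"
  let ?H = "vimage_algebra (space M) (\<lambda>\<xi>. \<lambda>i\<in>{..k}. s i \<xi>) (PiM {..k} (\<lambda>_. borel))"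
  have w: "w k \<in> borel_measurable ?G"
    by (rule measurable_vimage_algebra1) auto
  have path: "(\<lambda>\<xi>. \<lambda>i\<in>{..k}. s i \<xi>) \<in> measurable ?H (PiM {..k} (\<lambda>_. borel))"
    by (rule measurable_vimage_algebra1) (auto simp: space_PiM)
  have s: "s i \<in> borel_measurable ?H" if "i \<le> k" for i
    using measurable_compose[OF path measurable_component_singleton[of i]] that by simp
  have s0k: "(\<lambda>\<xi>. (s 0 \<xi>, s k \<xi>)) \<in> measurable ?H (borel \<Otimes>\<^sub>M borel)"
    using s by (intro measurable_Pair) auto
  show ?thesis
  proof (rule indep_set_imp_indep_var)
    show "indep_set (sets ?G) (sets ?H)"
      using tr by (simp add: trajectory_def)
  qed (use measurable_compose[OF w f] measurable_compose[OF s0k g] in auto)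
qed

text \<open>The conditional law given \<open>s 0 = x\<close> is replaced by integrals over the event \<open>s 0 = x\<close>, so
  every moment carries the factor \<open>prob {s 0 = x}\<close>. The induction runs over the bilinear form for
  all pairs of vectors, because the step replaces \<open>u\<close> by \<open>F\<^sup>T u\<close>. The mixed terms vanish since
  \<open>w k\<close> is independent of \<open>(s 0, s k)\<close> and has mean \<open>\<mu>\<close>.\<close>

lemma state_second_moment:
  fixes F C :: "real^'n^'n" and w s :: "nat \<Rightarrow> 'a \<Rightarrow> real^'n" and x :: "real^'n"
  assumes M: "prob_space M" and D: "prob_space D" "has_mean D \<mu>" "has_covariance D C"
    and w: "\<And>k. w k \<in> borel_measurable M" "\<And>k. distr M borel (w k) = D"
    and tr: "trajectory M F w s"
  defines "E \<equiv> {\<xi>\<in>space M. s 0 \<xi> = x}"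
  defines "Y \<equiv> \<lambda>k \<xi>. s k \<xi> - state_mean F \<mu> x k"
  shows "has_bochner_integral M (\<lambda>\<xi>. indicator {x} (s 0 \<xi>) * ((u \<bullet> Y k \<xi>) * (v \<bullet> Y k \<xi>)))
           (measure M E * (u \<bullet> (state_cov F C k *v v)))"
proof (induction k arbitrary: u v)
  case 0
  have zero: "indicator {x} (s 0 \<xi>) * ((u \<bullet> Y 0 \<xi>) * (v \<bullet> Y 0 \<xi>)) = (0 :: real)" for \<xi>
    by (auto simp: Y_def indicator_def)
  show ?case unfolding zero by (simp add: has_bochner_integral_zero)
next
  case (Suc k)
  interpret prob_space M by fact
  note w(1)[measurable]
  have sm [measurable]: "s i \<in> borel_measurable M" for i
    using tr by (simp add: trajectory_def)
  have E [measurable]: "E \<in> events"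
    unfolding E_def by measurable
  let ?e = "\<lambda>\<xi>. indicator {x} (s 0 \<xi>) :: real" and ?W = "\<lambda>\<xi>. w k \<xi> - \<mu>"
  have Y_Suc: "u \<bullet> Y (Suc k) \<xi> = (u v* F) \<bullet> Y k \<xi> + u \<bullet> ?W \<xi>" if "\<xi> \<in> space M" for u \<xi>
    using tr that unfolding Y_def
    by (simp add: trajectory_def dot_lmul_matrix matrix_vector_mult_diff_distrib
        inner_diff_right inner_add_right)
  have W_mean: "has_bochner_integral M (\<lambda>\<xi>. u \<bullet> ?W \<xi>) 0" for u
    using has_mean_centred[OF D(1,2), of u] unfolding w(2)[of k, symmetric]
    by (simp add: has_bochner_integral_iff integrable_distr_eq integral_distr)
  have W_cov: "has_bochner_integral M (\<lambda>\<xi>. (u \<bullet> ?W \<xi>) * (v \<bullet> ?W \<xi>)) (u \<bullet> (C *v v))" for u v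
    using has_covariance_form[OF D(2,3), of u v] unfolding w(2)[of k, symmetric]
    by (simp add: has_bochner_integral_iff integrable_distr_eq integral_distr)
  have eYW_indep: "indep_var borel (\<lambda>\<xi>. u \<bullet> ?W \<xi>) borel (\<lambda>\<xi>. ?e \<xi> * (v \<bullet> Y k \<xi>))" for u v
  proof -
    have "indep_var borel (\<lambda>\<xi>. u \<bullet> ?W \<xi>) borel
       (\<lambda>\<xi>. (\<lambda>(a, b). indicator {x} a * (v \<bullet> (b - state_mean F \<mu> x k))) (s 0 \<xi>, s k \<xi>))"
      by (rule trajectory_indep_var[OF M tr]) measurable
    then show ?thesis
      by (simp add: Y_def)
  qed
  have eW_indep: "indep_var borel (\<lambda>\<xi>. (u \<bullet> ?W \<xi>) * (v \<bullet> ?W \<xi>)) borel ?e" for u v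
  proof -
    have "indep_var borel (\<lambda>\<xi>. (u \<bullet> ?W \<xi>) * (v \<bullet> ?W \<xi>)) borel
       (\<lambda>\<xi>. (\<lambda>(a, b). indicator {x} a) (s 0 \<xi>, s k \<xi>))"
      by (rule trajectory_indep_var[OF M tr]) measurable
    then show ?thesis
      by simp
  qed
  \<comment> \<open>On a probability space a finite second moment bounds the first, since \<open>\<bar>a\<bar> \<le> 1 + a\<^sup>2\<close>.\<close>
  have eY_int: "integrable M (\<lambda>\<xi>. ?e \<xi> * (v \<bullet> Y k \<xi>))" for v
  proof (rule Bochner_Integration.integrable_bound)
    show "integrable M (\<lambda>\<xi>. 1 + ?e \<xi> * ((v \<bullet> Y k \<xi>) * (v \<bullet> Y k \<xi>)))"
      using Suc.IH[of v v] by (simp add: has_bochner_integral_iff)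
    show "(\<lambda>\<xi>. ?e \<xi> * (v \<bullet> Y k \<xi>)) \<in> borel_measurable M"
      unfolding Y_def by measurable
    have "\<bar>a\<bar> \<le> 1 + a * a" for a :: real
      using sum_squares_ge_zero[of "\<bar>a\<bar> - 1" 0] abs_mult_self_eq[of a]
      by (simp add: algebra_simps)
    then show "AE \<xi> in M. norm (?e \<xi> * (v \<bullet> Y k \<xi>))
        \<le> norm (1 + ?e \<xi> * ((v \<bullet> Y k \<xi>) * (v \<bullet> Y k \<xi>)))"
      by (auto simp: indicator_def intro!: AE_I2 order_trans[OF _ abs_ge_self])
  qed
  have e_int: "has_bochner_integral M ?e (prob E)"
  proof -
    have "has_bochner_integral M (indicator E) (prob E)"
      using E by (intro has_bochner_integral_real_indicator) (auto simp: less_top[symmetric])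
    then show ?thesis
      by (rule has_bochner_integral_cong[THEN iffD1, rotated -1]) (auto simp: E_def indicator_def)
  qed
  have mixed: "has_bochner_integral M (\<lambda>\<xi>. (u \<bullet> ?W \<xi>) * (?e \<xi> * (v \<bullet> Y k \<xi>))) 0" for u v
    using indep_var_integrable[OF eYW_indep _ eY_int] indep_var_lebesgue_integral[OF eYW_indep _ eY_int]
      W_mean by (simp add: has_bochner_integral_iff)
  have noise: "has_bochner_integral M (\<lambda>\<xi>. ((u \<bullet> ?W \<xi>) * (v \<bullet> ?W \<xi>)) * ?e \<xi>)
      ((u \<bullet> (C *v v)) * prob E)"
    using indep_var_integrable[OF eW_indep] indep_var_lebesgue_integral[OF eW_indep]
      W_cov e_int by (simp add: has_bochner_integral_iff)
  have "has_bochner_integral M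
     (\<lambda>\<xi>. (?e \<xi> * (((u v* F) \<bullet> Y k \<xi>) * ((v v* F) \<bullet> Y k \<xi>))
          + (v \<bullet> ?W \<xi>) * (?e \<xi> * ((u v* F) \<bullet> Y k \<xi>)))
        + ((u \<bullet> ?W \<xi>) * (?e \<xi> * ((v v* F) \<bullet> Y k \<xi>)) + ((u \<bullet> ?W \<xi>) * (v \<bullet> ?W \<xi>)) * ?e \<xi>))
     ((prob E * ((u v* F) \<bullet> (state_cov F C k *v (v v* F))) + 0)
        + (0 + (u \<bullet> (C *v v)) * prob E))"
    by (intro has_bochner_integral_add Suc.IH mixed noise)
  then show ?case
    unfolding state_cov_Suc_form
    by (rule has_bochner_integral_cong[THEN iffD1, rotated -1])
       (simp_all add: Y_Suc distrib_left distrib_right mult_ac add_ac)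
qed

section \<open>Chebyshev's inequality\<close>

text \<open>The squared Mahalanobis distance \<open>Y \<bullet> V\<^sup>-\<^sup>1 Y\<close> is the sum over the rows \<open>v\<close> of the inverse of \<open>V\<close>
  of \<open>(v \<bullet> Y) * Y $ i\<close>, so over \<open>E\<close> its integral is \<open>prob E\<close> times the trace of the identity,
  and Markov's inequality applies.\<close>

lemma (in prob_space) mahalanobis_chebyshev:
  fixes Y :: "'a \<Rightarrow> real^'n" and V :: "real^'n^'n"
  assumes Y [measurable]: "Y \<in> borel_measurable M" and E [measurable]: "E \<in> events"
    and moment: "\<And>u v. has_bochner_integral M (\<lambda>\<xi>. indicator E \<xi> * ((u \<bullet> Y \<xi>) * (v \<bullet> Y \<xi>)))
                    (prob E * (u \<bullet> (V *v v)))"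
    and pos: "\<And>u. u \<noteq> 0 \<Longrightarrow> u \<bullet> (V *v u) > 0"
    and "0 < \<epsilon>"
  shows "prob (E \<inter> {\<xi>\<in>space M. Y \<xi> \<bullet> (matrix_inv V *v Y \<xi>) \<le> real CARD('n) / \<epsilon>})
           \<ge> (1 - \<epsilon>) * prob E"
proof -
  let ?q = "\<lambda>y. y \<bullet> (matrix_inv V *v y)" and ?r = "real CARD('n) / \<epsilon>"
  have inv: "invertible V"
    using pos by (rule pos_form_invertible)
  have q_nonneg: "?q y \<ge> 0" for y
  proof -
    have "V *v (matrix_inv V *v y) = y"
      using inv by (simp add: invertible_matrix_inv_mult)
    then have "?q y = (matrix_inv V *v y) \<bullet> (V *v (matrix_inv V *v y))"
      by (simp add: inner_commute)
    also have "\<dots> \<ge> 0"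
      using pos[of "matrix_inv V *v y"] by (cases "matrix_inv V *v y = 0") auto
    finally show ?thesis .
  qed
  have [measurable]: "(\<lambda>\<xi>. ?q (Y \<xi>)) \<in> borel_measurable M"
    by (intro borel_measurable_inner Y borel_measurable_continuous_on[OF _ Y]) (intro continuous_intros)
  have q_sum: "?q y = (\<Sum>i\<in>UNIV. (row i (matrix_inv V) \<bullet> y) * (axis i 1 \<bullet> y))" for y
    by (simp add: inner_vec_def[of y] matrix_vector_mul_component row_def inner_axis' mult.commute)
  have trace: "row i (matrix_inv V) \<bullet> (V *v axis i 1) = 1" for i
  proof -
    have "row i (matrix_inv V) \<bullet> (V *v axis i 1) = (matrix_inv V *v (V *v axis i 1)) $ i"
      by (simp add: matrix_vector_mul_component row_def)
    also have "\<dots> = 1"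
      using inv by (simp add: invertible_matrix_inv_mult)
    finally show ?thesis .
  qed
  have q_int: "has_bochner_integral M (\<lambda>\<xi>. indicator E \<xi> * ?q (Y \<xi>)) (prob E * real CARD('n))"
  proof -
    have "has_bochner_integral M
        (\<lambda>\<xi>. \<Sum>i\<in>UNIV. indicator E \<xi> * ((row i (matrix_inv V) \<bullet> Y \<xi>) * (axis i 1 \<bullet> Y \<xi>)))
        (\<Sum>i\<in>UNIV. prob E * (row i (matrix_inv V) \<bullet> (V *v axis i 1)))"
      by (intro has_bochner_integral_sum moment)
    then show ?thesis
      unfolding q_sum trace by (simp add: sum_distrib_left mult.commute)
  qed
  let ?B = "{\<xi>\<in>space M. indicator E \<xi> * ?q (Y \<xi>) \<ge> ?r}"
  have "?r > 0" using \<open>0 < \<epsilon>\<close> by simp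
  then have "prob ?B \<le> (\<integral>\<xi>. indicator E \<xi> * ?q (Y \<xi>) \<partial>M) / ?r"
    using q_int q_nonneg
    by (intro integral_Markov_inequality_measure[where A="{}"]) (auto simp: has_bochner_integral_iff)
  also have "\<dots> = \<epsilon> * prob E"
    using q_int \<open>0 < \<epsilon>\<close> by (simp add: has_bochner_integral_iff)
  finally have "prob ?B \<le> \<epsilon> * prob E" .
  moreover have "prob E \<le> prob (E \<inter> {\<xi>\<in>space M. ?q (Y \<xi>) \<le> ?r} \<union> ?B)"
    using sets.sets_into_space[OF E] by (intro finite_measure_mono) (auto simp: indicator_def)
  moreover have "\<dots> \<le> prob (E \<inter> {\<xi>\<in>space M. ?q (Y \<xi>) \<le> ?r}) + prob ?B"
    by (intro measure_Un_le) measurable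
  ultimately show ?thesis
    by (simp add: algebra_simps)
qed

section \<open>Probabilistic invariance\<close>

theorem proposition3:
  fixes A :: "real^'n^'n" and B :: "real^'m^'n" and K :: "real^'n^'m"
    and X :: "(real^'n) set" and U :: "(real^'m) set"
    and HX :: "((real^'n) \<times> real) set" and HU :: "((real^'m) \<times> real) set"
    and \<omega> :: "(real^'n) measure" and \<mu> :: "real^'n" and C :: "real^'n^'n"
    and M :: "'a measure" and w :: "nat \<Rightarrow> 'a \<Rightarrow> real^'n"
    and \<epsilon> :: real and R :: "(real^'n) set"
  assumes "strictly_stabilizable A B"
    and "polyhedron X" and "polytope U"
    and "0 \<in> interior X" and "0 \<in> interior U"
    and "irredundant_rep HX X" and "irredundant_rep HU U"
    and "prob_space \<omega>" and "sets \<omega> = sets borel"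
    and "has_mean \<omega> \<mu>" and "has_covariance \<omega> C" and "sym_pos_def C"
    and "strictly_stable (A + B ** K)"
    and "prob_space M" and "iid_disturbance M \<omega> w"
    and "0 < \<epsilon>" and "\<epsilon> < 1"
    and "\<forall>s\<^sub>0\<in>R. (*v) (A + B ** K) ` R + ellipsoid C \<mu> (real CARD('n) / \<epsilon>) \<subseteq> R"
  shows "prob_pos_invariant M (A + B ** K) w (1 - \<epsilon>) R"
  unfolding prob_pos_invariant_def
proof (intro ballI allI impI)
  interpret prob_space M by fact
  let ?F = "A + B ** K"
  fix x s and k :: nat
  assume x: "x \<in> R" and tr: "trajectory M ?F w s"
    and p: "\<P>(\<xi> in M. s 0 \<xi> = x) > 0" and "k \<ge> 1"
  have w: "w i \<in> borel_measurable M" "distr M borel (w i) = \<omega>" for i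
    using \<open>iid_disturbance M \<omega> w\<close> by (auto simp: iid_disturbance_def indep_vars_def)
  have [measurable]: "s i \<in> borel_measurable M" for i
    using tr by (simp add: trajectory_def)
  have C_pos: "u \<bullet> (C *v u) > 0" if "u \<noteq> 0" for u
    using \<open>sym_pos_def C\<close> that by (simp add: sym_pos_def_def)
  define m where "m = state_mean ?F \<mu> x k"
  define V where "V = state_cov ?F C k"
  define E where "E = {\<xi>\<in>space M. s 0 \<xi> = x}"
  define G where "G = {\<xi>\<in>space M. (s k \<xi> - m) \<bullet> (matrix_inv V *v (s k \<xi> - m)) \<le> real CARD('n) / \<epsilon>}"
  have V_pos: "u \<bullet> (V *v u) > 0" if "u \<noteq> 0" for u
    using state_cov_Suc_pos[OF C_pos that, of ?F "k - 1"] \<open>k \<ge> 1\<close> by (simp add: V_def)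
  have [measurable]: "E \<in> events"
    unfolding E_def by measurable
  have "(\<lambda>y. (y - m) \<bullet> (matrix_inv V *v (y - m))) \<in> borel_measurable borel"
    by (intro borel_measurable_continuous_onI continuous_intros
        continuous_on_compose2[OF matrix_vector_mult_linear_continuous_on]) auto
  then have G: "G \<in> events"
    unfolding G_def by measurable
  have "prob (E \<inter> G) \<ge> (1 - \<epsilon>) * prob E"
    unfolding G_def
  proof (rule mahalanobis_chebyshev[OF _ _ _ V_pos \<open>0 < \<epsilon>\<close>])
    show "has_bochner_integral M (\<lambda>\<xi>. indicator E \<xi> * ((u \<bullet> (s k \<xi> - m)) * (v \<bullet> (s k \<xi> - m))))
        (prob E * (u \<bullet> (V *v v)))" for u v
      using state_second_moment[OF \<open>prob_space M\<close> \<open>prob_space \<omega>\<close> \<open>has_mean \<omega> \<mu>\<close>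
            \<open>has_covariance \<omega> C\<close> w tr, of x u k v]
      unfolding m_def V_def E_def
      by (rule has_bochner_integral_cong[THEN iffD1, rotated -1]) (auto simp: indicator_def)
  qed measurable
  moreover have "\<P>(\<xi> in M. \<xi> \<in> G \<bar> s 0 \<xi> = x) = prob (E \<inter> G) / prob E"
    unfolding cond_prob_def E_def G_def
    by (intro arg_cong2[where f="(/)"] arg_cong[where f=prob]) auto
  ultimately have "\<P>(\<xi> in M. \<xi> \<in> G \<bar> s 0 \<xi> = x) \<ge> 1 - \<epsilon>"
    using p by (simp add: E_def pos_le_divide_eq)
  moreover have "s k \<xi> \<in> R" if "\<xi> \<in> G" for \<xi>
  proof -
    define u where "u = matrix_inv V *v (s k \<xi> - m)"
    have Vu: "V *v u = s k \<xi> - m"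
      using pos_form_invertible[OF V_pos]
      by (simp add: u_def invertible_matrix_inv_mult)
    then have "u \<bullet> (V *v u) \<le> real CARD('n) / \<epsilon>"
      using that by (simp add: G_def u_def inner_commute)
    then have "m + V *v u \<in> R"
      using assms(18) x unfolding m_def V_def
      by (intro state_ellipsoid_subset[OF C_pos]) auto
    then show ?thesis by (simp add: Vu)
  qed
  ultimately show "\<exists>E\<in>sets M. E \<subseteq> {\<xi>\<in>space M. s k \<xi> \<in> R} \<and>
                  \<P>(\<xi> in M. \<xi> \<in> E \<bar> s 0 \<xi> = x) \<ge> 1 - \<epsilon>"
    using G by (intro bexI[of _ G]) (auto simp: G_def)
qed

end
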